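(* Let $p\le n$ be positive integers and let $G\in\mathbb{H}^{n\times n}$ be Hermitian positive definite. Then the set $$\mathrm{St}_G(p,\mathbb{H}^n)=\{X\in\mathbb{H}^{n\times p}\mid X^H G X=I_p\}$$ is a real embedded submanifold of $\mathbb{H}^{n\times p}$ of real dimension $p(4n-2p+1)$. Strictly speaking, $\psi(\mathrm{St}_G(p,\mathbb{H}^n))$ is an embedded submanifold of $\psi(\mathbb{H}^{n\times p})\simeq\mathbb{R}^{4np}$ of dimension $p(4n-2p+1)$.
   Context: $\mathbb{H}$ denotes the quaternions $q=q_0+q_1i+q_2j+q_3k$ ($q_l\in\mathbb{R}$, $i^2=j^2=k^2=ijk=-1$), with conjugate $\bar q=q_0-q_1i-q_2j-q_3k$. For a quaternionic matrix $A$, $A^H=\bar A^{\top}$ is the conjugate transpose. A matrix $G\in\mathbb{H}^{n\times n}$ is Hermitian if $G^H=G$, and Hermitian positive definite if moreover $x^HGx>0$ for every nonzero $x\in\mathbb{H}^n$ (for Hermitian $G$ the quaternion $x^HGx$ is always real). $\mathbb{H}^{n\times p}$ is regarded as a real vector space of dimension $4np$ via the real-linear isomorphism $\psi:\mathbb{H}^{n\times p}\to(\mathbb{R}^{n\times p})^4\simeq\mathbb{R}^{4np}$, $\psi(A_0+A_1i+A_2j+A_3k)=(A_0,A_1,A_2,A_3)$ with $A_0,A_1,A_2,A_3\in\mathbb{R}^{n\times p}$. *)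

theory Defs
  imports "HOL-Analysis.Analysis"
begin

section \<open>Quaternions\<close>

datatype quat = Quat (qre: real) (qim1: real) (qim2: real) (qim3: real)

instantiation quat :: real_algebra_1
begin

definition zero_quat :: quat where "0 = Quat 0 0 0 0"

definition one_quat :: quat where "1 = Quat 1 0 0 0"

definition plus_quat :: "quat \<Rightarrow> quat \<Rightarrow> quat" where
  "a + b = Quat (qre a + qre b) (qim1 a + qim1 b) (qim2 a + qim2 b) (qim3 a + qim3 b)"

definition minus_quat :: "quat \<Rightarrow> quat \<Rightarrow> quat" where
  "a - b = Quat (qre a - qre b) (qim1 a - qim1 b) (qim2 a - qim2 b) (qim3 a - qim3 b)"

definition uminus_quat :: "quat \<Rightarrow> quat" where
  "- a = Quat (- qre a) (- qim1 a) (- qim2 a) (- qim3 a)"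

definition scaleR_quat :: "real \<Rightarrow> quat \<Rightarrow> quat" where
  "r *\<^sub>R a = Quat (r * qre a) (r * qim1 a) (r * qim2 a) (r * qim3 a)"

definition times_quat :: "quat \<Rightarrow> quat \<Rightarrow> quat" where
  "a * b = Quat
    (qre a * qre b - qim1 a * qim1 b - qim2 a * qim2 b - qim3 a * qim3 b)
    (qre a * qim1 b + qim1 a * qre b + qim2 a * qim3 b - qim3 a * qim2 b)
    (qre a * qim2 b - qim1 a * qim3 b + qim2 a * qre b + qim3 a * qim1 b)
    (qre a * qim3 b + qim1 a * qim2 b - qim2 a * qim1 b + qim3 a * qre b)"

instance
  by standard
    (simp_all add: zero_quat_def one_quat_def plus_quat_def minus_quat_def uminus_quat_def
      scaleR_quat_def times_quat_def algebra_simps)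

end

lemma quat_sel_simps [simp]:
  "qre 0 = 0" "qim1 0 = 0" "qim2 0 = 0" "qim3 0 = 0"
  "qre 1 = 1" "qim1 1 = 0" "qim2 1 = 0" "qim3 1 = 0"
  "qre (a + b) = qre a + qre b" "qim1 (a + b) = qim1 a + qim1 b"
  "qim2 (a + b) = qim2 a + qim2 b" "qim3 (a + b) = qim3 a + qim3 b"
  "qre (r *\<^sub>R a) = r * qre a" "qim1 (r *\<^sub>R a) = r * qim1 a"
  "qim2 (r *\<^sub>R a) = r * qim2 a" "qim3 (r *\<^sub>R a) = r * qim3 a"
  by (simp_all add: zero_quat_def one_quat_def plus_quat_def scaleR_quat_def)

lemma quat_units:
  fixes i j k :: quat
  defines "i \<equiv> Quat 0 1 0 0" and "j \<equiv> Quat 0 0 1 0" and "k \<equiv> Quat 0 0 0 1"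
  shows "i * i = - 1" "j * j = - 1" "k * k = - 1" "i * j * k = - 1"
    "q = of_real (qre q) + of_real (qim1 q) * i + of_real (qim2 q) * j + of_real (qim3 q) * k"
  by (simp_all add: i_def j_def k_def of_real_def times_quat_def uminus_quat_def one_quat_def
      plus_quat_def scaleR_quat_def)

definition qcnj :: "quat \<Rightarrow> quat" where
  "qcnj q = Quat (qre q) (- qim1 q) (- qim2 q) (- qim3 q)"

section \<open>Quaternionic matrices\<close>

definition conj_transpose :: "quat ^ 'm ^ 'n \<Rightarrow> quat ^ 'n ^ 'm" where
  "conj_transpose A = (\<chi> i j. qcnj (A $ j $ i))"

definition qhermitian :: "quat ^ 'n ^ 'n \<Rightarrow> bool" where
  "qhermitian G \<longleftrightarrow> conj_transpose G = G"

definition quad_form :: "quat ^ 'n ^ 'n \<Rightarrow> quat ^ 'n \<Rightarrow> quat" where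
  "quad_form G x = (\<Sum>i\<in>UNIV. qcnj (x $ i) * (G *v x) $ i)"

text \<open>Quaternions carry no order here, so \<open>x\<^sup>H G x > 0\<close> is spelled out as
  \<open>x\<^sup>H G x\<close> being a positive real number.\<close>

definition hermitian_pos_def :: "quat ^ 'n ^ 'n \<Rightarrow> bool" where
  "hermitian_pos_def G \<longleftrightarrow>
     qhermitian G \<and> (\<forall>x. x \<noteq> 0 \<longrightarrow> (\<exists>r>0. quad_form G x = of_real r))"

definition stiefel :: "quat ^ 'n ^ 'n \<Rightarrow> (quat ^ 'p ^ 'n) set" where
  "stiefel G = {X. conj_transpose X ** G ** X = mat 1}"

definition psi ::
  "quat ^ 'p ^ 'n \<Rightarrow> (real ^ 'p ^ 'n) \<times> (real ^ 'p ^ 'n) \<times> (real ^ 'p ^ 'n) \<times> (real ^ 'p ^ 'n)"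
  where
  "psi A = (\<chi> i j. qre (A $ i $ j), \<chi> i j. qim1 (A $ i $ j),
            \<chi> i j. qim2 (A $ i $ j), \<chi> i j. qim3 (A $ i $ j))"

lemma linear_psi: "linear psi"
  by (rule linearI) (simp_all add: psi_def vec_eq_iff)

lemma bij_psi: "bij psi"
proof (rule bijI)
  show "inj psi"
    by (rule injI) (simp add: psi_def vec_eq_iff quat.expand)
  show "surj psi"
  proof (rule surjI)
    show "psi ((\<lambda>(A, B, C, D). \<chi> i j. Quat (A $ i $ j) (B $ i $ j) (C $ i $ j) (D $ i $ j)) Y) = Y"
      for Y
      by (cases Y) (simp add: psi_def vec_eq_iff)
  qed
qed

lemma DIM_psi_codomain:
  "DIM((real ^ 'p ^ 'n) \<times> (real ^ 'p ^ 'n) \<times> (real ^ 'p ^ 'n) \<times> (real ^ 'p ^ 'n))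
     = 4 * CARD('n) * CARD('p)"
  by simp

section \<open>Embedded submanifolds of a Euclidean space\<close>

text \<open>For open \<open>U\<close>, \<open>Ck_on k f U\<close> says that \<open>f\<close> is \<open>k\<close> times continuously differentiable on \<open>U\<close>:
  as the domain is finite-dimensional, continuity of the derivative amounts to continuity of
  all directional derivatives.\<close>

primrec Ck_on ::
  "nat \<Rightarrow> ('a::euclidean_space \<Rightarrow> 'b::euclidean_space) \<Rightarrow> 'a set \<Rightarrow> bool" where
  "Ck_on 0 f U \<longleftrightarrow> continuous_on U f"
| "Ck_on (Suc k) f U \<longleftrightarrow>
     (\<forall>x\<in>U. f differentiable (at x)) \<and>
     (\<forall>v. Ck_on k (\<lambda>x. frechet_derivative f (at x) v) U)"

definition smooth_on ::
  "('a::euclidean_space \<Rightarrow> 'b::euclidean_space) \<Rightarrow> 'a set \<Rightarrow> bool" where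
  "smooth_on f U \<longleftrightarrow> (\<forall>k. Ck_on k f U)"

definition diffeomorphism ::
  "'a::euclidean_space set \<Rightarrow> 'b::euclidean_space set \<Rightarrow> ('a \<Rightarrow> 'b) \<Rightarrow> ('b \<Rightarrow> 'a) \<Rightarrow> bool" where
  "diffeomorphism U V f g \<longleftrightarrow>
     open U \<and> open V \<and> homeomorphism U V f g \<and> smooth_on f U \<and> smooth_on g V"

text \<open>Smooth slice charts. The model \<open>\<real>\<^sup>d \<times> {0}\<close> is taken up to a linear change of coordinates,
  i.e. as a \<open>d\<close>-dimensional linear subspace \<open>L\<close>. Since the empty set satisfies the slice condition
  for every \<open>d\<close>, nonemptiness is what makes \<open>d\<close> the dimension of \<open>S\<close>.\<close>

definition embedded_submanifold :: "'a::euclidean_space set \<Rightarrow> nat \<Rightarrow> bool" where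
  "embedded_submanifold S d \<longleftrightarrow>
     S \<noteq> {} \<and>
     (\<forall>x\<in>S. \<exists>U V (f :: 'a \<Rightarrow> 'a) g L. x \<in> U \<and> diffeomorphism U V f g \<and>
        subspace L \<and> dim L = d \<and> f ` (S \<inter> U) = L \<inter> V)"

end

theory Submission
  imports Defs
begin

text \<open>Write \<open>h(X) = X\<^sup>H G X\<close>. This is a quadratic map into the Hermitian \<open>p \<times> p\<close> matrices, and
  the Stiefel manifold is its level set \<open>h = I\<close>. At a point \<open>A\<close> of the level set the
  differential \<open>T(Y) = A\<^sup>H G Y + Y\<^sup>H G A\<close> maps onto the Hermitian matrices, because
  \<open>R(M) = A M / 2\<close> is a right inverse: \<open>T(A M / 2) = (M + M\<^sup>H) / 2 = M\<close>. So \<open>I\<close> is a regular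
  value, and the dimension is \<open>4np\<close> minus the dimension \<open>p (2p - 1)\<close> of the space of Hermitian
  matrices.

  Since \<open>h\<close> is quadratic, the slice chart is explicit. The map
  \<open>f(X) = (X - A) + R(h(X - A))\<close> satisfies \<open>T(f(X)) = T(X - A) + h(X - A) = h(X) - I\<close>, so it
  carries the level set into the linear subspace \<open>ker T\<close>; and its derivative at \<open>A\<close> is the
  identity, so the inverse function theorem makes it a local homeomorphism with differentiable
  inverse \<open>g\<close>. This is \<open>quadric_slice_chart\<close>.

  The chart must be a \<open>C\<^sup>\<infinity>\<close> diffeomorphism. Here too the quadratic form of \<open>f\<close> helps: its
  second derivative is a constant bilinear map \<open>C\<close>, and differentiating \<open>f'(g(y)) (g'(y) v) = v\<close>
  gives \<open>D\<^sub>u D\<^sub>v g = - g' (C (D\<^sub>u g) (D\<^sub>v g))\<close>. The right-hand side is polynomial in the first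
  directional derivatives of \<open>g\<close>, so these gain one order of differentiability at a time
  (\<open>inverse_smooth_on\<close>).

  The level set is nonempty by the Gram-Schmidt process. Each new vector comes from counting real
  dimensions: while a column of \<open>X\<close> is still zero, the real-linear map \<open>Y \<mapsto> X\<^sup>H G Y\<close> misses
  \<open>I\<close>, so for \<open>p \<le> n\<close> it has a nonzero kernel (\<open>exists_partial_orthonormal_frame\<close>).\<close>

section \<open>Calculus of k times continuously differentiable maps\<close>

lemma Ck_on_cong:
  assumes "open U" "\<And>x. x \<in> U \<Longrightarrow> f x = g x" "Ck_on k f U"
  shows "Ck_on k g U"
  using assms(2,3)
proof (induction k arbitrary: f g)
  case 0
  then show ?case by (simp cong: continuous_on_cong)
next
  case (Suc k)
  have d: "(g has_derivative frechet_derivative f (at x)) (at x)" if "x \<in> U" for x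
    using Suc.prems that frechet_derivative_works[of f "at x"] assms(1)
    by (auto intro: has_derivative_transform_within_open[where s=U])
  have "Ck_on k (\<lambda>x. frechet_derivative g (at x) v) U" for v
  proof (rule Suc.IH)
    show "Ck_on k (\<lambda>x. frechet_derivative f (at x) v) U"
      using Suc.prems by simp
  qed (use d frechet_derivative_at in metis)
  then show ?case
    using d by (auto simp: differentiable_def)
qed

lemma Ck_on_SucI:
  assumes "open U" "\<And>x. x \<in> U \<Longrightarrow> (f has_derivative f' x) (at x)"
    and "\<And>v. Ck_on k (\<lambda>x. f' x v) U"
  shows "Ck_on (Suc k) f U"
proof -
  have "Ck_on k (\<lambda>x. frechet_derivative f (at x) v) U" for v
    by (rule Ck_on_cong[OF assms(1) _ assms(3)[of v]])
      (metis assms(2) frechet_derivative_at)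
  then show ?thesis
    using assms(2) by (auto simp: differentiable_def)
qed

lemma Ck_on_has_derivative:
  assumes "Ck_on (Suc k) f U" "x \<in> U"
  shows "(f has_derivative frechet_derivative f (at x)) (at x)"
  using assms frechet_derivative_works by auto

lemma Ck_on_Suc_imp_Ck_on:
  assumes "Ck_on (Suc k) f U"
  shows "Ck_on k f U"
  using assms
proof (induction k arbitrary: f)
  case 0
  then show ?case
    by (auto intro!: continuous_at_imp_continuous_on differentiable_imp_continuous_within)
next
  case (Suc k)
  then show ?case by auto
qed

lemma Ck_on_const: "open U \<Longrightarrow> Ck_on k (\<lambda>x. c) U"
proof (induction k arbitrary: c)
  case (Suc k)
  then show ?case by (intro Ck_on_SucI[where f' = "\<lambda>x v. 0"]) auto
qed simp

lemma Ck_on_ident: "open U \<Longrightarrow> Ck_on k (\<lambda>x. x) U"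
proof (cases k)
  case (Suc k)
  assume "open U"
  then show ?thesis
    unfolding Suc by (intro Ck_on_SucI[where f' = "\<lambda>x v. v"]) (auto intro: Ck_on_const)
qed simp

lemma Ck_on_add:
  assumes "open U" "Ck_on k f U" "Ck_on k g U"
  shows "Ck_on k (\<lambda>x. f x + g x) U"
  using assms(2,3)
proof (induction k arbitrary: f g)
  case 0
  then show ?case by (simp add: continuous_on_add)
next
  case (Suc k)
  show ?case
  proof (rule Ck_on_SucI[OF assms(1)])
    show "((\<lambda>x. f x + g x) has_derivative
        (\<lambda>v. frechet_derivative f (at x) v + frechet_derivative g (at x) v)) (at x)"
      if "x \<in> U" for x
      using Suc.prems that by (intro has_derivative_add Ck_on_has_derivative)
  qed (use Suc in auto)
qed

lemma Ck_on_sum: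
  assumes "open U" "\<And>i. i \<in> I \<Longrightarrow> Ck_on k (f i) U"
  shows "Ck_on k (\<lambda>x. \<Sum>i\<in>I. f i x) U"
  using assms(2)
  by (induction I rule: infinite_finite_induct) (auto intro: Ck_on_const Ck_on_add assms(1))

text \<open>The Leibniz rule keeps the shape of the expression, so all products (real multiples, inner
  products, bilinear maps) are covered by one induction on \<open>k\<close>.\<close>

lemma Ck_on_bilinear:
  assumes "bounded_bilinear mlt" "open U" "Ck_on k f U" "Ck_on k g U"
  shows "Ck_on k (\<lambda>x. mlt (f x) (g x)) U"
  using assms(3,4)
proof (induction k arbitrary: f g)
  case 0
  then show ?case by (simp add: bounded_bilinear.continuous_on[OF assms(1)])
next
  case (Suc k)
  note low = Suc.prems[THEN Ck_on_Suc_imp_Ck_on]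
  show ?case
  proof (rule Ck_on_SucI[OF assms(2)])
    show "((\<lambda>x. mlt (f x) (g x)) has_derivative
        (\<lambda>v. mlt (f x) (frechet_derivative g (at x) v) + mlt (frechet_derivative f (at x) v) (g x))) (at x)"
      if "x \<in> U" for x
      using Suc.prems that by (intro bounded_bilinear.FDERIV[OF assms(1)] Ck_on_has_derivative)
    show "Ck_on k (\<lambda>x. mlt (f x) (frechet_derivative g (at x) v)
        + mlt (frechet_derivative f (at x) v) (g x)) U" for v
      using Suc.prems low by (intro Ck_on_add Suc.IH assms(2)) auto
  qed
qed

section \<open>Smoothness of the inverse of a quadratic map\<close>

text \<open>A product with a merely continuous second factor is differentiable at a zero of the
  first: the error \<open>C (f z) (h z - h y)\<close> is \<open>O(|z - y|) \<cdot> o(1)\<close>. This is what allows the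
  derivative of an inverse to be differentiated knowing only that it is continuous.\<close>

lemma has_derivative_bilinear_vanishing:
  fixes f :: "'a::real_normed_vector \<Rightarrow> 'b::real_normed_vector"
  assumes C: "bounded_bilinear C" and f: "(f has_derivative f') (at y)" and "f y = 0"
    and h: "isCont h y"
  shows "((\<lambda>z. C (f z) (h z)) has_derivative (\<lambda>u. C (f' u) (h y))) (at y)"
proof -
  interpret C: bounded_bilinear C by (fact C)
  obtain K where K: "\<And>a b. norm (C a b) \<le> norm a * norm b * K" "K > 0"
    using C.pos_bounded by metis
  interpret f': bounded_linear f' using f by (rule has_derivative_bounded_linear)
  obtain B where B: "\<And>u. norm (f' u) \<le> norm u * B" "B > 0"
    using f'.pos_bounded by metis
  \<comment> \<open>the relative error of the linear approximation of \<open>f\<close>\<close>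
  define q where "q z = norm (f z - f' (z - y)) / norm (z - y)" for z
  have q: "(q \<longlongrightarrow> 0) (at y)"
    using f \<open>f y = 0\<close> by (simp add: has_derivative_iff_norm q_def[abs_def])
  have f_le: "norm (f z) \<le> norm (z - y) * (q z + B)" if "z \<noteq> y" for z
  proof -
    have "norm (f z) \<le> norm (f z - f' (z - y)) + norm (f' (z - y))"
      using norm_triangle_sub by (metis add.commute)
    also have "norm (f z - f' (z - y)) = norm (z - y) * q z"
      using that by (simp add: q_def)
    finally show ?thesis using B(1)[of "z - y"] by (simp add: algebra_simps)
  qed
  have "((\<lambda>z. norm (C (f z) (h z - h y)) / norm (z - y)) \<longlongrightarrow> 0) (at y)"
  proof (rule real_tendsto_sandwich[where f = "\<lambda>_. 0" and h = "\<lambda>z. (q z + B) * norm (h z - h y) * K"])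
    have "norm (C (f z) (h z - h y)) / norm (z - y) \<le> (q z + B) * norm (h z - h y) * K"
      if "z \<noteq> y" for z
    proof -
      have "norm (C (f z) (h z - h y)) \<le> norm (f z) * norm (h z - h y) * K"
        by (rule K)
      also have "\<dots> \<le> (norm (z - y) * (q z + B)) * norm (h z - h y) * K"
        using f_le[OF that] K(2) by (intro mult_right_mono) auto
      finally show ?thesis using that by (simp add: field_simps)
    qed
    then show "\<forall>\<^sub>F z in at y. norm (C (f z) (h z - h y)) / norm (z - y)
        \<le> (q z + B) * norm (h z - h y) * K"
      by (auto simp: eventually_at_filter)
    have "((\<lambda>z. h z - h y) \<longlongrightarrow> 0) (at y)"
      using h by (simp add: isCont_def LIM_zero)
    then show "((\<lambda>z. (q z + B) * norm (h z - h y) * K) \<longlongrightarrow> 0) (at y)"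
      using tendsto_mult[OF tendsto_mult[OF tendsto_add[OF q tendsto_const[of B]]
            tendsto_norm] tendsto_const[of K]]
      by fastforce
  qed auto
  then have "((\<lambda>z. C (f z) (h z - h y)) has_derivative (\<lambda>u. 0)) (at y)"
    by (simp add: has_derivative_iff_norm C.zero_right)
  moreover have "((\<lambda>z. C (f z) (h y)) has_derivative (\<lambda>u. C (f' u) (h y))) (at y)"
    by (rule bounded_linear.has_derivative[OF C.bounded_linear_left f])
  ultimately have "((\<lambda>z. C (f z) (h z - h y) + C (f z) (h y))
      has_derivative (\<lambda>u. 0 + C (f' u) (h y))) (at y)"
    by (rule has_derivative_add)
  then show ?thesis by (simp add: C.diff_right)
qed

text \<open>In the application \<open>g\<close> is the inverse of a map with derivative \<open>w + C (x - a) w\<close> at \<open>x\<close>.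
  Subtracting the equations for \<open>g' z v\<close> and \<open>g' y v\<close> gives
  \<open>g' z v - g' y v = - g' y (C (g z - g y) (g' z v))\<close>, from which continuity and
  then differentiability of \<open>g' z v\<close> in \<open>z\<close> can be read off. The bound with the factor 2 states
  that the derivatives are uniformly invertible.\<close>

lemma inverse_derivative_has_derivative:
  fixes C :: "'a::euclidean_space \<Rightarrow> 'a \<Rightarrow> 'a"
  assumes C: "bounded_bilinear C"
    and "open V" and g: "\<And>y. y \<in> V \<Longrightarrow> (g has_derivative g' y) (at y)"
    and inv: "\<And>y v. y \<in> V \<Longrightarrow> g' y v + C (g y - a) (g' y v) = v"
    and inj: "\<And>y w. y \<in> V \<Longrightarrow> norm w \<le> 2 * norm (w + C (g y - a) w)"
    and y: "y \<in> V"
  shows "((\<lambda>z. g' z v) has_derivative (\<lambda>u. - g' y (C (g' y u) (g' y v)))) (at y)"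
proof -
  interpret C: bounded_bilinear C by (fact C)
  interpret G: bounded_linear "g' y" using g[OF y] by (rule has_derivative_bounded_linear)
  have bnd: "norm (g' z v) \<le> 2 * norm v" if "z \<in> V" for z v
    using inj[OF that, of "g' z v"] inv[OF that, of v] by simp
  have uniq: "w = g' z v" if "z \<in> V" "w + C (g z - a) w = v" for z w v
  proof -
    have "(w - g' z v) + C (g z - a) (w - g' z v) = 0"
      using that inv[OF that(1), of v] by (simp add: C.diff_right algebra_simps)
    then show ?thesis using inj[OF that(1), of "w - g' z v"] by simp
  qed
  have diff: "g' z v = g' y v - g' y (C (g z - g y) (g' z v))" if "z \<in> V" for z
  proof -
    have "g' z v + C (g y - a) (g' z v) = v - C (g z - g y) (g' z v)"
      using inv[OF that, of v] by (simp add: C.diff_left algebra_simps)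
    from uniq[OF y this] show ?thesis by (simp add: G.diff)
  qed
  have gy: "((\<lambda>z. g z - g y) has_derivative g' y) (at y)"
    using g[OF y] by (auto intro!: derivative_eq_intros)
  have cont: "isCont (\<lambda>z. g' z v) y"
  proof -
    obtain K where K: "\<And>a b. norm (C a b) \<le> norm a * norm b * K" "K > 0"
      using C.pos_bounded by metis
    have ev: "\<forall>\<^sub>F z in at y. norm (C (g z - g y) (g' z v)) \<le> norm (g z - g y) * (2 * norm v) * K"
    proof -
      have "\<forall>\<^sub>F z in at y. z \<in> V"
        using \<open>open V\<close> y by (rule eventually_at_in_open')
      then show ?thesis
      proof eventually_elim
        case (elim z)
        show ?case
          using K(2) bnd[OF elim]
          by (intro order_trans[OF K(1)] mult_right_mono mult_left_mono) auto
      qed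
    qed
    have "((\<lambda>z. g z - g y) \<longlongrightarrow> 0) (at y)"
      using has_derivative_continuous[OF g[OF y]] by (simp add: continuous_within LIM_zero)
    then have "((\<lambda>z. norm (g z - g y) * (2 * norm v) * K) \<longlongrightarrow> 0) (at y)"
      using tendsto_mult[OF tendsto_mult[OF tendsto_norm tendsto_const[of "2 * norm v"]]
            tendsto_const[of K]]
      by fastforce
    from Lim_null_comparison[OF ev this] have "((\<lambda>z. C (g z - g y) (g' z v)) \<longlongrightarrow> 0) (at y)" .
    from tendsto_diff[OF tendsto_const[of "g' y v"] G.tendsto[OF this]]
    have "((\<lambda>z. g' y v - g' y (C (g z - g y) (g' z v))) \<longlongrightarrow> g' y v) (at y)"
      by (simp add: G.zero)
    moreover have "\<forall>\<^sub>F z in at y. g' y v - g' y (C (g z - g y) (g' z v)) = g' z v"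
      using eventually_at_in_open'[OF \<open>open V\<close> y] by eventually_elim (metis diff)
    ultimately show ?thesis
      unfolding isCont_def by (rule Lim_transform_eventually)
  qed
  have "((\<lambda>z. C (g z - g y) (g' z v)) has_derivative (\<lambda>u. C (g' y u) (g' y v))) (at y)"
    using has_derivative_bilinear_vanishing[OF C gy _ cont] by simp
  from has_derivative_diff[OF has_derivative_const[of "g' y v"] G.has_derivative[OF this]]
  have "((\<lambda>z. g' y v - g' y (C (g z - g y) (g' z v))) has_derivative
      (\<lambda>u. - g' y (C (g' y u) (g' y v)))) (at y)"
    by simp
  then show ?thesis
    by (rule has_derivative_transform_within_open[OF _ \<open>open V\<close> y]) (metis diff)
qed

text \<open>The formula \<open>D\<^sub>u D\<^sub>v g = - g' (C (D\<^sub>u g) (D\<^sub>v g))\<close>, with the outer \<open>g'\<close> expanded in an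
  orthonormal basis, expresses the second derivatives of \<open>g\<close> polynomially through its first
  derivatives. So if all \<open>D\<^sub>v g\<close> are \<open>C\<^sup>k\<close>, then they are \<open>C\<^sup>k\<^sup>+\<^sup>1\<close>.\<close>

lemma inverse_smooth_on:
  fixes C :: "'a::euclidean_space \<Rightarrow> 'a \<Rightarrow> 'a"
  assumes C: "bounded_bilinear C"
    and "open V" and g: "\<And>y. y \<in> V \<Longrightarrow> (g has_derivative g' y) (at y)"
    and inv: "\<And>y v. y \<in> V \<Longrightarrow> g' y v + C (g y - a) (g' y v) = v"
    and inj: "\<And>y w. y \<in> V \<Longrightarrow> norm w \<le> 2 * norm (w + C (g y - a) w)"
  shows "smooth_on g V"
proof -
  note deriv2 = inverse_derivative_has_derivative[OF assms]
  have expand: "- g' y w = (\<Sum>b\<in>Basis. (w \<bullet> (- b)) *\<^sub>R g' y b)" if "y \<in> V" for y w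
  proof -
    interpret G: bounded_linear "g' y" using g[OF that] by (rule has_derivative_bounded_linear)
    have "g' y w = g' y (\<Sum>b\<in>Basis. (w \<bullet> b) *\<^sub>R b)"
      by (simp add: euclidean_representation)
    then show ?thesis
      by (simp add: G.sum G.scale sum_negf)
  qed
  have "Ck_on k (\<lambda>y. g' y v) V" for k v
  proof (induction k arbitrary: v)
    case 0
    have "continuous_on V (\<lambda>y. g' y v)"
      using deriv2 by (intro has_derivative_continuous_on) (blast intro: has_derivative_at_withinI)
    then show ?case by simp
  next
    case (Suc k)
    show ?case
    proof (rule Ck_on_SucI[OF \<open>open V\<close> deriv2])
      fix u
      have "Ck_on k (\<lambda>y. \<Sum>b\<in>Basis. (C (g' y u) (g' y v) \<bullet> (- b)) *\<^sub>R g' y b) V"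
        by (intro Ck_on_sum Ck_on_bilinear[OF bounded_bilinear_scaleR]
            Ck_on_bilinear[OF bounded_bilinear_inner]
            Ck_on_bilinear[OF C] Ck_on_const Suc.IH \<open>open V\<close>)
      then show "Ck_on k (\<lambda>y. - g' y (C (g' y u) (g' y v))) V"
        by (rule Ck_on_cong[OF \<open>open V\<close>, rotated]) (simp add: expand)
    qed
  qed
  then have "Ck_on (Suc k) g V" for k
    using Ck_on_SucI[OF \<open>open V\<close> g] by blast
  then show ?thesis
    unfolding smooth_on_def using Ck_on_Suc_imp_Ck_on by blast
qed

section \<open>Slice charts for level sets of quadratic maps\<close>

lemma perturbed_identity_injective_bound:
  fixes w :: "'a::real_normed_vector"
  assumes "norm d \<le> norm w / 2"
  shows "norm w \<le> 2 * norm (w + d)"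
  using assms norm_diff_ineq[of w d] by linarith

lemma quadratic_has_derivative:
  fixes N :: "'a::euclidean_space \<Rightarrow> 'a \<Rightarrow> 'a"
  assumes "bounded_bilinear N"
  shows "((\<lambda>x. (x - a) + N (x - a) (x - a)) has_derivative
    (\<lambda>v. v + (N (x - a) v + N v (x - a)))) (at x)"
  by (auto intro!: derivative_eq_intros bounded_bilinear.FDERIV[OF assms])

text \<open>The derivative at \<open>a\<close> is the identity, so the inverse function theorem applies there. It is
  applied on a ball around \<open>a\<close> on which the derivative differs from the identity by at most
  1/2; this provides the uniform invertibility used for the smoothness of the inverse.\<close>

lemma quadratic_local_diffeomorphism:
  fixes N :: "'a::euclidean_space \<Rightarrow> 'a \<Rightarrow> 'a"
  assumes N: "bounded_bilinear N"
  obtains U V g where "a \<in> U"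
    "diffeomorphism U V (\<lambda>x. (x - a) + N (x - a) (x - a)) g"
proof -
  interpret N: bounded_bilinear N by (fact N)
  define f where "f x = (x - a) + N (x - a) (x - a)" for x
  define C where "C h w = N h w + N w h" for h w
  have C: "bounded_bilinear C"
    using N N.flip unfolding C_def[abs_def]
    by (simp add: bilinear_conv_bounded_bilinear[symmetric] bilinear_def linear_compose_add)
  interpret C: bounded_bilinear C by (fact C)
  obtain K where K: "\<And>h w. norm (C h w) \<le> norm h * norm w * K" "K > 0"
    using C.pos_bounded by metis
  define U0 where "U0 = ball a (1 / (2 * K))"
  have a: "a \<in> U0" and U0: "open U0"
    using K(2) by (auto simp: U0_def)
  have inj: "norm w \<le> 2 * norm (w + C (x - a) w)" if "x \<in> U0" for x w
  proof (rule perturbed_identity_injective_bound)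
    have "norm (x - a) * K \<le> 1 / 2"
      using that K(2) by (simp add: U0_def dist_norm norm_minus_commute field_simps)
    then have "norm (x - a) * K * norm w \<le> 1 / 2 * norm w"
      by (rule mult_right_mono) simp
    then show "norm (C (x - a) w) \<le> norm w / 2"
      using K(1)[of "x - a" w] by (simp add: mult_ac)
  qed
  define f' where "f' x = Blinfun (\<lambda>w. w + C (x - a) w)" for x
  have f'_apply: "blinfun_apply (f' x) = (\<lambda>w. w + C (x - a) w)" for x
    unfolding f'_def
    by (intro bounded_linear_Blinfun_apply bounded_linear_add bounded_linear_ident
        C.bounded_linear_right)
  have f': "(f has_derivative blinfun_apply (f' x)) (at x)" for x
    unfolding f_def[abs_def] f'_apply C_def by (rule quadratic_has_derivative[OF N])
  have "continuous_on U0 (\<lambda>x. blinfun_apply (f' x) i)" for i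
    unfolding f'_apply
    by (intro continuous_on_add continuous_on_const C.continuous_on continuous_on_diff continuous_on_id)
  then have contf': "continuous_on U0 f'"
    by (rule continuous_on_blinfun_componentwise)
  have invf': "id_blinfun o\<^sub>L f' a = id_blinfun"
    by (rule blinfun_eqI) (simp add: f'_apply C.zero_left)
  obtain U V g g' where U: "open U" "U \<subseteq> U0" "a \<in> U" and V: "open V"
    and hom: "homeomorphism U V f g"
    and g: "\<And>y. y \<in> V \<Longrightarrow> (g has_derivative (g' y)) (at y)"
    and g': "\<And>y. y \<in> V \<Longrightarrow> g' y = inv (blinfun_apply (f' (g y)))"
    and bij: "\<And>y. y \<in> V \<Longrightarrow> bij (blinfun_apply (f' (g y)))"
    by (rule inverse_function_theorem[OF U0 f' contf' a invf']) (rule that; assumption)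
  have gU: "g y \<in> U0" if "y \<in> V" for y
    using homeomorphism_image2[OF hom] that U(2) by blast
  have "smooth_on g V"
  proof (rule inverse_smooth_on[OF C V g])
    show "g' y v + C (g y - a) (g' y v) = v" if "y \<in> V" for y v
      using surj_f_inv_f[OF bij_is_surj[OF bij[OF that]], of v] by (simp add: g'[OF that] f'_apply)
  qed (use inj gU in auto)
  moreover have "smooth_on f U"
  proof -
    have "Ck_on k (\<lambda>x. x - a) U" for k
      using Ck_on_add[OF U(1) Ck_on_ident[OF U(1)] Ck_on_const[OF U(1), of _ "- a"]] by simp
    then show ?thesis
      unfolding smooth_on_def f_def[abs_def]
      by (intro allI Ck_on_add Ck_on_bilinear[OF N] U(1))
  qed
  ultimately have "diffeomorphism U V f g"
    using U V hom by (simp add: diffeomorphism_def)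
  with that U(3) show thesis
    unfolding f_def[abs_def] by blast
qed

text \<open>Since \<open>R\<close> inverts the differential \<open>T h = B a h + B h a\<close> on the values of the quadratic form,
  the correction \<open>R (B (x - a) (x - a))\<close> in the chart \<open>f\<close> absorbs the quadratic
  term: \<open>T (f x) = B x x - B a a\<close>. Hence \<open>f\<close> sends the level set through \<open>a\<close> to the
  kernel of \<open>T\<close>.\<close>

lemma quadric_slice_chart:
  fixes B :: "'a::euclidean_space \<Rightarrow> 'a \<Rightarrow> 'b::euclidean_space"
  assumes B: "bounded_bilinear B" and "linear R"
    and R: "\<And>h. B a (R (B h h)) + B (R (B h h)) a = B h h"
  obtains U V and f :: "'a \<Rightarrow> 'a" and g where "a \<in> U" "diffeomorphism U V f g"
    "f ` ({x. B x x = B a a} \<inter> U) = {h. B a h + B h a = 0} \<inter> V"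
proof -
  interpret B: bounded_bilinear B by (fact B)
  define N where "N h w = R (B h w)" for h w
  have N: "bounded_bilinear N"
    using B \<open>linear R\<close> linear_compose[of _ R]
    unfolding N_def[abs_def] bilinear_conv_bounded_bilinear[symmetric] bilinear_def o_def by blast
  define f where "f x = (x - a) + N (x - a) (x - a)" for x
  obtain U V g where a: "a \<in> U" and diff: "diffeomorphism U V f g"
    using quadratic_local_diffeomorphism[OF N] unfolding f_def[abs_def] by blast
  have "B a (f x) + B (f x) a = B x x - B a a" for x
  proof -
    have "B a (f x) + B (f x) a = B a (x - a) + B (x - a) a + B (x - a) (x - a)"
      unfolding f_def N_def B.add_left B.add_right using R[of "x - a"] by (simp add: add_ac)
    also have "\<dots> = B x x - B a a"
      by (simp add: B.diff_left B.diff_right)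
    finally show ?thesis .
  qed
  then have "{x. B x x = B a a} = f -` {h. B a h + B h a = 0}"
    by auto
  moreover have "f ` U = V"
    using diff by (simp add: diffeomorphism_def homeomorphism_def)
  ultimately have "f ` ({x. B x x = B a a} \<inter> U) = {h. B a h + B h a = 0} \<inter> V"
    by auto
  with that a diff show thesis by blast
qed

section \<open>Dimensions of matrix spaces\<close>

lemma dim_supported_matrices:
  fixes P :: "('n::finite \<times> 'm::finite) set"
  shows "dim {M :: real^'m^'n. \<forall>i j. (i, j) \<notin> P \<longrightarrow> M $ i $ j = 0} = card P"
proof -
  define d where "d = (\<lambda>(i, j). axis i (axis j (1::real)) :: real^'m^'n) ` P"
  have inj: "inj_on (\<lambda>(i, j). axis i (axis j (1::real)) :: real^'m^'n) P"
    by (auto simp: inj_on_def axis_eq_axis)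
  have mem: "axis i (axis j (1::real)) \<in> d \<longleftrightarrow> (i, j) \<in> P" for i j
    by (auto simp: d_def axis_eq_axis)
  have sub: "d \<subseteq> Basis"
    by (auto simp: d_def Basis_vec_def)
  have entry: "M \<bullet> axis i (axis j 1) = M $ i $ j" for M :: "real^'m^'n" and i j
    by (simp add: inner_axis)
  have "(\<forall>b\<in>Basis. b \<notin> d \<longrightarrow> M \<bullet> b = 0) \<longleftrightarrow> (\<forall>i j. (i, j) \<notin> P \<longrightarrow> M $ i $ j = 0)" for M
  proof -
    have "(\<forall>b\<in>Basis. b \<notin> d \<longrightarrow> M \<bullet> b = 0)
        \<longleftrightarrow> (\<forall>i j. axis i (axis j 1) \<notin> d \<longrightarrow> M \<bullet> axis i (axis j 1) = 0)"
      unfolding Basis_vec_def Basis_real_def by blast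
    then show ?thesis unfolding mem entry .
  qed
  with dim_substandard[OF sub] show ?thesis
    by (simp add: d_def card_image[OF inj])
qed

lemma linear_transpose: "linear (transpose :: real^'m^'n \<Rightarrow> real^'n^'m)"
  by (rule linearI) (simp_all add: transpose_def vec_eq_iff)

text \<open>A symmetric (\<open>s = 1\<close>) or skew-symmetric (\<open>s = -1\<close>) matrix is determined by its entries on a set
  \<open>P\<close> of positions that contains exactly one of each transposed pair and, in the symmetric case
  only, the diagonal; and these entries can be prescribed freely.\<close>

lemma dim_transpose_eigenspace:
  fixes s :: real and P :: "('p::finite \<times> 'p) set"
  assumes cover: "\<And>i j. (i, j) \<in> P \<or> (j, i) \<in> P \<or> s = -1 \<and> i = j"
    and sym: "\<And>i j. (i, j) \<in> P \<Longrightarrow> (j, i) \<in> P \<Longrightarrow> i = j \<and> s = 1"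
    and s: "s * s = 1"
  shows "dim {M :: real^'p^'p. transpose M = s *\<^sub>R M} = card P" (is "dim ?S = _")
proof -
  define t where "t M = (\<chi> i j. if (i, j) \<in> P then M $ i $ j else 0)" for M :: "real^'p^'p"
  have lin: "linear t"
    by (rule linearI) (simp_all add: t_def vec_eq_iff)
  have entry: "M $ j $ i = s * M $ i $ j" if "M \<in> ?S" for M i j
  proof -
    have "transpose M $ i $ j = (s *\<^sub>R M) $ i $ j" using that by simp
    then show ?thesis by (simp add: transpose_def)
  qed
  have sub: "subspace ?S"
    using linear_transpose[where 'm='p and 'n='p]
    by (auto simp: subspace_def linear_0 linear_add linear_scale algebra_simps)
  have "inj_on t ?S"
  proof (rule inj_onI)
    fix M N assume M: "M \<in> ?S" and N: "N \<in> ?S" and eq: "t M = t N"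
    have P: "M $ i $ j = N $ i $ j" if "(i, j) \<in> P" for i j
    proof -
      have "t M $ i $ j = t N $ i $ j" using eq by simp
      then show ?thesis using that by (simp add: t_def)
    qed
    have "M $ i $ j = N $ i $ j" for i j
    proof -
      consider "(i, j) \<in> P" | "(j, i) \<in> P" | "s = -1" "i = j" using cover by blast
      then show ?thesis
      proof cases
        case 2
        then show ?thesis using P[OF 2] entry[OF M, of i j] entry[OF N, of i j] by metis
      next
        case 3
        then show ?thesis using entry[OF M, of i i] entry[OF N, of i i] by simp
      qed (rule P)
    qed
    then show "M = N" by (simp add: vec_eq_iff)
  qed
  moreover have "t ` ?S = {M. \<forall>i j. (i, j) \<notin> P \<longrightarrow> M $ i $ j = 0}"
  proof (intro equalityI subsetI)
    fix M :: "real^'p^'p" assume "M \<in> {M. \<forall>i j. (i, j) \<notin> P \<longrightarrow> M $ i $ j = 0}"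
    then have M: "M $ i $ j = 0" if "(i, j) \<notin> P" for i j using that by blast
    define N where "N = (\<chi> i j. if (i, j) \<in> P then M $ i $ j else s * M $ j $ i)"
    have entry_N: "N $ j $ i = s * N $ i $ j" for i j
    proof (cases "(i, j) \<in> P \<and> (j, i) \<in> P")
      case True
      then show ?thesis using sym[of i j] by simp
    next
      case False
      then show ?thesis
        using M[of i j] M[of j i] s by (auto simp: N_def mult.assoc[symmetric])
    qed
    have "transpose N $ i $ j = (s *\<^sub>R N) $ i $ j" for i j
      unfolding transpose_def vector_scaleR_component real_scaleR_def vec_lambda_beta
      by (rule entry_N)
    then have "N \<in> ?S"
      unfolding mem_Collect_eq vec_eq_iff by blast
    moreover have "t N = M"
      using M by (simp add: t_def N_def vec_eq_iff)
    ultimately show "M \<in> t ` ?S" by blast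
  qed (auto simp: t_def)
  moreover have "span ?S = ?S"
    using sub by (rule span_eq_iff[THEN iffD2])
  ultimately show ?thesis
    using dim_image_eq[OF lin, of ?S] dim_supported_matrices[of P] by metis
qed

text \<open>The left-hand side is the real dimension of the space of Hermitian quaternionic matrices:
  their real part is symmetric and the three imaginary parts are skew-symmetric. The index type
  is ordered through an injection into \<open>nat\<close>, which splits the positions into the upper
  triangle \<open>U\<close>, the diagonal \<open>D\<close> and the lower triangle \<open>W\<close>.\<close>

lemma dim_symmetric_skew_matrices:
  "dim {M :: real^'p^'p. transpose M = M} + 3 * dim {M :: real^'p::finite^'p. transpose M = - M}
    = CARD('p) * (2 * CARD('p) - 1)"
proof -
  obtain e :: "'p \<Rightarrow> nat" where e: "inj e"
    using finite_imp_inj_to_nat_seg[OF finite[of "UNIV :: 'p set"]] by metis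
  define U where "U = {(i, j). e i < e j}"
  define D where "D = {(i::'p, j). i = j}"
  define W where "W = {(i, j). e j < e i}"
  have neq: "e i = e j \<longleftrightarrow> i = j" for i j
    using e by (auto dest: injD)
  have sym: "dim {M :: real^'p^'p. transpose M = 1 *\<^sub>R M} = card (U \<union> D)"
    by (rule dim_transpose_eigenspace) (auto simp: U_def D_def neq[symmetric])
  have skew: "dim {M :: real^'p^'p. transpose M = (-1) *\<^sub>R M} = card U"
    by (rule dim_transpose_eigenspace) (auto simp: U_def neq[symmetric])
  have "card D = CARD('p)"
  proof -
    have "D = (\<lambda>i. (i, i)) ` UNIV" by (auto simp: D_def)
    then show ?thesis by (simp add: card_image inj_on_def)
  qed
  moreover have "card W = card U"
  proof -
    have "W = prod.swap ` U" by (auto simp: U_def W_def image_iff)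
    then show ?thesis by (simp add: card_image)
  qed
  moreover have "card (U \<union> D) = card U + card D"
    by (rule card_Un_disjoint) (auto simp: U_def D_def)
  moreover have "card (U \<union> D \<union> W) = card (U \<union> D) + card W"
    by (rule card_Un_disjoint) (auto simp: U_def D_def W_def)
  moreover have "U \<union> D \<union> W = UNIV"
    by (auto simp: U_def D_def W_def neq[symmetric])
  ultimately have "CARD('p) * CARD('p) = 2 * card U + CARD('p)"
    by (simp add: card_cartesian_product flip: UNIV_Times_UNIV)
  moreover have "CARD('p) * (2 * CARD('p) - 1) = 2 * (CARD('p) * CARD('p)) - CARD('p)"
    by (simp add: diff_mult_distrib2)
  ultimately show ?thesis
    using sym skew \<open>card (U \<union> D) = card U + card D\<close> \<open>card D = CARD('p)\<close> by simp
qed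

text \<open>\<open>T\<close> is injective on the orthogonal complement of its kernel and has the same range there.\<close>

lemma dim_kernel_range:
  fixes T :: "'a::euclidean_space \<Rightarrow> 'b::euclidean_space"
  assumes "linear T"
  shows "dim {x. T x = 0} + dim (range T) = DIM('a)"
proof -
  interpret T: linear T by fact
  let ?K = "{x. T x = 0}"
  let ?O = "{y \<in> UNIV. \<forall>x\<in>?K. orthogonal x y}"
  have K: "subspace ?K" using assms by (rule linear_subspace_kernel)
  have O: "subspace ?O" using subspace_orthogonal_to_vectors[of ?K] by simp
  have "inj_on T ?O"
  proof (rule inj_onI)
    fix x y assume "x \<in> ?O" "y \<in> ?O" and eq: "T x = T y"
    then have "x - y \<in> ?O" using O subspace_diff by blast
    moreover have "x - y \<in> ?K" using eq by (simp add: T.diff)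
    ultimately have "orthogonal (x - y) (x - y)" by blast
    then show "x = y" by (simp add: orthogonal_self)
  qed
  then have "dim (T ` ?O) = dim ?O"
    using O by (intro dim_image_eq[OF assms]) (simp add: span_eq_iff[THEN iffD2])
  moreover have "range T = T ` ?O"
  proof (intro equalityI subsetI)
    fix b assume "b \<in> range T"
    then obtain x where x: "b = T x" by blast
    obtain k y where k: "k \<in> span ?K" and y: "\<And>w. w \<in> span ?K \<Longrightarrow> orthogonal y w"
      and xy: "x = k + y"
      using orthogonal_subspace_decomp_exists[of ?K x] by metis
    have "k \<in> ?K" using k K by (simp add: span_eq_iff[THEN iffD2])
    then have "b = T y" using x xy by (simp add: T.add)
    moreover have "y \<in> ?O" using y[OF span_base] by (simp add: orthogonal_commute)
    ultimately show "b \<in> T ` ?O" by blast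
  qed auto
  moreover have "dim ?O + dim ?K = DIM('a)"
    using dim_subspace_orthogonal_to_vectors[OF K subspace_UNIV] by simp
  ultimately show ?thesis by simp
qed

section \<open>Quaternionic matrices and the Gram matrix\<close>

lemma qcnj_simps [simp]:
  "qre (qcnj a) = qre a" "qim1 (qcnj a) = - qim1 a" "qim2 (qcnj a) = - qim2 a"
  "qim3 (qcnj a) = - qim3 a"
  by (simp_all add: qcnj_def)

lemma qcnj_add: "qcnj (a + b) = qcnj a + qcnj b"
  and qcnj_scaleR: "qcnj (r *\<^sub>R a) = r *\<^sub>R qcnj a"
  and qcnj_mult: "qcnj (a * b) = qcnj b * qcnj a"
  and qcnj_qcnj: "qcnj (qcnj a) = a"
  and qcnj_zero: "qcnj 0 = 0"
  by (simp_all add: quat.expand times_quat_def algebra_simps)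

lemma qcnj_sum: "qcnj (sum f S) = (\<Sum>i\<in>S. qcnj (f i))"
  by (induction S rule: infinite_finite_induct) (simp_all add: qcnj_add qcnj_zero)

lemma conj_transpose_mult: "conj_transpose (A ** B) = conj_transpose B ** conj_transpose A"
  by (simp add: conj_transpose_def matrix_matrix_mult_def vec_eq_iff qcnj_sum qcnj_mult)

lemma conj_transpose_conj_transpose: "conj_transpose (conj_transpose A) = A"
  by (simp add: conj_transpose_def vec_eq_iff qcnj_qcnj)

lemma conj_transpose_add: "conj_transpose (A + B) = conj_transpose A + conj_transpose B"
  and conj_transpose_scaleR: "conj_transpose (r *\<^sub>R A) = r *\<^sub>R conj_transpose A"
  by (simp_all add: conj_transpose_def vec_eq_iff qcnj_add qcnj_scaleR)

lemma quat_matrix_scaleR_left: "(r *\<^sub>R A) ** B = r *\<^sub>R (A ** (B :: quat ^ 'k ^ 'm))"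
  and quat_matrix_scaleR_right: "A ** (r *\<^sub>R B) = r *\<^sub>R (A ** (B :: quat ^ 'k ^ 'm))"
  by (simp_all add: matrix_matrix_mult_def vec_eq_iff scaleR_sum_right)

lemma quat_matrix_add_rdistrib: "(A + B) ** C = A ** C + B ** (C :: quat ^ 'k ^ 'm)"
  by (simp add: matrix_matrix_mult_def vec_eq_iff distrib_right sum.distrib)

definition gram :: "quat ^ 'n ^ 'n \<Rightarrow> quat ^ 'p ^ 'n \<Rightarrow> quat ^ 'q ^ 'n \<Rightarrow> quat ^ 'q ^ 'p" where
  "gram G X Y = conj_transpose X ** G ** Y"

lemma linear_gram_right: "linear (gram G X)"
  by (rule linearI) (simp_all add: gram_def matrix_add_ldistrib quat_matrix_scaleR_right)

lemma linear_gram_left: "linear (\<lambda>X. gram G X Y)"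
  by (rule linearI)
    (simp_all add: gram_def conj_transpose_add conj_transpose_scaleR quat_matrix_add_rdistrib
      quat_matrix_scaleR_left)

lemma conj_transpose_gram:
  "qhermitian G \<Longrightarrow> conj_transpose (gram G X Y) = gram G Y X"
  by (simp add: gram_def conj_transpose_mult conj_transpose_conj_transpose qhermitian_def
      matrix_mul_assoc)

lemma gram_mult_right: "gram G X (Y ** M) = gram G X Y ** M"
  and gram_mult_left: "gram G (X ** M) Y = conj_transpose M ** gram G X Y"
  by (simp_all add: gram_def conj_transpose_mult matrix_mul_assoc)

lemma gram_entry:
  "gram G X Y $ i $ j = (\<Sum>k\<in>UNIV. qcnj (X $ k $ i) * (G *v column j Y) $ k)"
  by (simp add: gram_def conj_transpose_def matrix_mul_assoc[symmetric])
    (simp add: matrix_matrix_mult_def matrix_vector_mult_def column_def)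

lemma gram_diagonal_entry: "gram G X X $ i $ i = quad_form G (column i X)"
  by (simp add: gram_entry quad_form_def column_def)

lemma stiefel_iff_gram: "X \<in> stiefel G \<longleftrightarrow> gram G X X = mat 1"
  by (simp add: stiefel_def gram_def)

section \<open>Real coordinates of quaternionic matrices\<close>

type_synonym ('p, 'n) quat_coords =
  "(real ^ 'p ^ 'n) \<times> (real ^ 'p ^ 'n) \<times> (real ^ 'p ^ 'n) \<times> (real ^ 'p ^ 'n)"

lemma inv_psi_psi: "inv psi (psi X) = X"
  by (rule inv_f_f[OF bij_is_inj[OF bij_psi]])

lemma psi_inv_psi: "psi (inv psi x) = x"
  by (rule surj_f_inv_f[OF bij_is_surj[OF bij_psi]])

lemma linear_inv_psi: "linear (inv psi)"
  by (rule linearI; rule inv_f_eq[OF bij_is_inj[OF bij_psi]])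
    (simp_all add: linear_add[OF linear_psi] linear_scale[OF linear_psi] psi_inv_psi)

text \<open>The domain has real dimension \<open>4np\<close>, at least the dimension \<open>4p\<^sup>2\<close> of the codomain, so an
  injective map would be surjective.\<close>

lemma quat_matrix_map_not_injective:
  fixes T :: "quat ^ 'p::finite ^ 'n::finite \<Rightarrow> quat ^ 'p ^ 'p"
  assumes "CARD('p) \<le> CARD('n)" and T: "linear T" and "\<not> surj T"
  obtains Y where "Y \<noteq> 0" "T Y = 0"
proof -
  define T' where "T' = psi \<circ> T \<circ> inv psi"
  have lin: "linear T'"
    unfolding T'_def by (intro linear_compose linear_inv_psi linear_psi T)
  have "\<not> inj T"
  proof
    assume "inj T"
    then have inj: "inj T'"
      unfolding T'_def by (metis inj_on_inverseI inj_compose inv_psi_psi psi_inv_psi)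
    then have "dim (range T') = 4 * CARD('n) * CARD('p)"
      using dim_image_eq[OF lin, of UNIV] by (simp add: DIM_psi_codomain)
    moreover have "dim (range T') \<le> 4 * CARD('p) * CARD('p)"
      using dim_subset_UNIV[of "range T'"] by simp
    ultimately have "dim (range T') = DIM(('p, 'p) quat_coords)"
      using mult_le_mono1[OF assms(1), of "4 * CARD('p)"] by (simp add: mult_ac)
    then have "span (range T') = UNIV"
      by (simp only: dim_eq_full)
    moreover have "subspace (range T')"
      using lin by (simp add: linear_subspace_image)
    ultimately have "surj T'"
      by (metis span_eq_iff)
    have "surj T"
    proof (rule surjI)
      show "T (inv psi (inv T' (psi M))) = M" for M
        using surj_f_inv_f[OF \<open>surj T'\<close>, of "psi M"]
        by (metis T'_def comp_apply inv_psi_psi)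
    qed
    with \<open>\<not> surj T\<close> show False ..
  qed
  then show thesis
    using that T linear_injective_0 by blast
qed

lemma psi_hermitian_matrices:
  "psi ` {M :: quat ^ 'p ^ 'p. qhermitian M}
    = {M. transpose M = M} \<times> {M. transpose M = - M} \<times> {M. transpose M = - M} \<times> {M. transpose M = - M}"
    (is "_ = ?R")
proof -
  have "qhermitian M \<longleftrightarrow> psi M \<in> ?R" for M :: "quat ^ 'p ^ 'p"
  proof -
    have entry: "qcnj x = y \<longleftrightarrow> qre x = qre y \<and> qim1 x = - qim1 y \<and> qim2 x = - qim2 y
        \<and> qim3 x = - qim3 y" for x y
      by (auto simp: quat.expand)
    have "qhermitian M \<longleftrightarrow> (\<forall>i j. qre (M $ j $ i) = qre (M $ i $ j)
        \<and> qim1 (M $ j $ i) = - qim1 (M $ i $ j) \<and> qim2 (M $ j $ i) = - qim2 (M $ i $ j)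
        \<and> qim3 (M $ j $ i) = - qim3 (M $ i $ j))"
      unfolding qhermitian_def conj_transpose_def vec_eq_iff vec_lambda_beta entry ..
    also have "\<dots> \<longleftrightarrow> psi M \<in> ?R"
      unfolding psi_def transpose_def vec_eq_iff mem_Times_iff fst_conv snd_conv mem_Collect_eq
        vec_lambda_beta vector_uminus_component by blast
    finally show ?thesis .
  qed
  then have "{M :: quat ^ 'p ^ 'p. qhermitian M} = psi -` ?R" by auto
  then show ?thesis
    by (simp only: surj_image_vimage_eq[OF bij_is_surj[OF bij_psi]])
qed

lemma dim_psi_hermitian_matrices:
  "dim (psi ` {M :: quat ^ 'p::finite ^ 'p. qhermitian M}) = CARD('p) * (2 * CARD('p) - 1)"
proof -
  have sub: "subspace {M :: real^'p^'p. transpose M = s *\<^sub>R M}" for s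
    using linear_transpose[where 'm='p and 'n='p]
    by (auto simp: subspace_def linear_0 linear_add linear_scale algebra_simps)
  from sub[of 1] sub[of "-1"]
  have "subspace {M :: real^'p^'p. transpose M = M}" "subspace {M :: real^'p^'p. transpose M = - M}"
    by simp_all
  then have "dim (psi ` {M :: quat ^ 'p ^ 'p. qhermitian M})
      = dim {M :: real^'p^'p. transpose M = M} + 3 * dim {M :: real^'p^'p. transpose M = - M}"
    unfolding psi_hermitian_matrices by (simp add: dim_Times subspace_Times)
  then show ?thesis by (simp add: dim_symmetric_skew_matrices)
qed

section \<open>Existence of orthonormal frames\<close>

text \<open>Gram-Schmidt, one index at a time; the columns with index outside \<open>A\<close> are zero. Only the
  next column \<open>a\<close> is replaced, by a normalized vector \<open>v\<close> that is orthogonal to all columns of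
  \<open>X\<close>. Such a \<open>v\<close> is a nonzero column of some \<open>Y\<close> with \<open>X\<^sup>H G Y = 0\<close>.\<close>

lemma exists_partial_orthonormal_frame:
  fixes G :: "quat ^ 'n::finite ^ 'n" and A :: "'p::finite set"
  assumes le: "CARD('p) \<le> CARD('n)" and G: "hermitian_pos_def G"
  shows "\<exists>X :: quat ^ 'p ^ 'n. gram G X X = (\<chi> i j. if i = j \<and> i \<in> A then 1 else 0)"
  using finite[of A]
proof (induction A rule: finite_induct)
  case empty
  have "gram G (0 :: quat ^ 'p ^ 'n) 0 = 0"
    using linear_gram_right by (rule linear_0)
  then show ?case by (intro exI[of _ 0]) (simp add: vec_eq_iff)
next
  case (insert a A)
  then obtain X :: "quat ^ 'p ^ 'n"
    where X: "gram G X X = (\<chi> i j. if i = j \<and> i \<in> A then 1 else 0)" by blast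
  have herm: "qhermitian G" and pos: "\<And>x. x \<noteq> 0 \<Longrightarrow> \<exists>r>0. quad_form G x = of_real r"
    using G by (auto simp: hermitian_pos_def_def)
  \<comment> \<open>Positivity forces column \<open>a\<close> of \<open>X\<close> to vanish, so row \<open>a\<close> of every \<open>X\<^sup>H G Y\<close> is zero.\<close>
  have "quad_form G (column a X) = 0"
    using X insert.hyps by (simp add: gram_diagonal_entry[symmetric])
  then have "column a X = 0"
    using pos[of "column a X"] by (metis less_irrefl of_real_eq_0_iff)
  then have "gram G X Y $ a $ j = 0" for Y :: "quat ^ 'p ^ 'n" and j
    by (simp add: gram_entry column_def vec_eq_iff qcnj_zero)
  then have "mat 1 \<noteq> gram G X Y" for Y :: "quat ^ 'p ^ 'n"
    by (auto simp: mat_def vec_eq_iff intro!: exI[of _ a])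
  then have not_surj: "\<not> surj (gram G X :: quat ^ 'p ^ 'n \<Rightarrow> _)"
    unfolding surj_def by blast
  then obtain Y :: "quat ^ 'p ^ 'n" where "Y \<noteq> 0" and Y: "gram G X Y = 0"
    by (rule quat_matrix_map_not_injective[OF le linear_gram_right])
  then obtain c where c: "column c Y \<noteq> 0"
    by (auto simp: vec_eq_iff column_def)
  define v where "v = column c Y"
  obtain r where r: "r > 0" "quad_form G v = of_real r"
    using pos[of v] c unfolding v_def by blast
  define X' :: "quat ^ 'p ^ 'n" where
    "X' = (\<chi> k j. if j = a then (1 / sqrt r) *\<^sub>R v $ k else X $ k $ j)"
  have col_a: "column a X' = (1 / sqrt r) *\<^sub>R v"
    by (simp add: X'_def column_def vec_eq_iff)
  have col: "column j X' = column j X" if "j \<noteq> a" for j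
    using that by (simp add: X'_def column_def vec_eq_iff)
  have scale: "G *v ((1 / sqrt r) *\<^sub>R v) = (1 / sqrt r) *\<^sub>R (G *v v)"
    by (simp add: matrix_vector_mult_def vec_eq_iff scaleR_sum_right)
  have aa: "gram G X' X' $ a $ a = 1"
  proof -
    have "gram G X' X' $ a $ a = (1 / sqrt r) *\<^sub>R (1 / sqrt r) *\<^sub>R quad_form G v"
      unfolding gram_diagonal_entry col_a
      by (simp add: quad_form_def scale qcnj_scaleR scaleR_sum_right)
    then show ?thesis using r by (simp add: of_real_def)
  qed
  have ia: "gram G X' X' $ i $ a = 0" if "i \<noteq> a" for i
  proof -
    have "gram G X' X' $ i $ a = (1 / sqrt r) *\<^sub>R gram G X Y $ i $ c"
      unfolding gram_entry col_a scale
      using that by (simp add: X'_def v_def scaleR_sum_right)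
    then show ?thesis by (simp add: Y)
  qed
  have ai: "gram G X' X' $ a $ i = 0" if "i \<noteq> a" for i
  proof -
    have "gram G X' X' $ a $ i = conj_transpose (gram G X' X') $ a $ i"
      by (simp add: conj_transpose_gram[OF herm])
    then show ?thesis by (simp add: conj_transpose_def ia[OF that] qcnj_zero)
  qed
  have ij: "gram G X' X' $ i $ j = gram G X X $ i $ j" if "i \<noteq> a" "j \<noteq> a" for i j
    unfolding gram_entry col[OF that(2)] using that by (simp add: X'_def)
  have "gram G X' X' $ i $ j = (if i = j \<and> i \<in> insert a A then 1 else 0)" for i j
    by (cases "i = a"; cases "j = a") (use aa ia ai ij X in auto)
  then show ?case
    by (intro exI[of _ X']) (simp add: vec_eq_iff)
qed

lemma stiefel_nonempty:
  fixes G :: "quat ^ 'n::finite ^ 'n"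
  assumes "CARD('p::finite) \<le> CARD('n)" "hermitian_pos_def G"
  shows "(stiefel G :: (quat ^ 'p ^ 'n) set) \<noteq> {}"
  using exists_partial_orthonormal_frame[OF assms, of UNIV]
  by (auto simp: stiefel_iff_gram mat_def)

section \<open>The Stiefel manifold\<close>

theorem proposition1:
  fixes G :: "quat ^ 'n::finite ^ 'n"
  assumes "CARD('p::finite) \<le> CARD('n)"
    and "hermitian_pos_def G"
  shows "embedded_submanifold (psi ` (stiefel G :: (quat ^ 'p ^ 'n) set))
           (CARD('p) * (4 * CARD('n) - 2 * CARD('p) + 1))"
proof -
  let ?S = "psi ` (stiefel G :: (quat ^ 'p ^ 'n) set)"
  let ?d = "CARD('p) * (4 * CARD('n) - 2 * CARD('p) + 1)"
  have herm: "qhermitian G" using assms(2) by (simp add: hermitian_pos_def_def)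
  define B where "B x y = psi (gram G (inv psi x) (inv psi y) :: quat ^ 'p ^ 'p)"
    for x y :: "('p, 'n) quat_coords"
  have "linear (B x)" for x
    using linear_compose[OF linear_compose[OF linear_inv_psi linear_gram_right] linear_psi]
    by (simp add: B_def[abs_def] o_def)
  moreover have "linear (\<lambda>x. B x y)" for y
    using linear_compose[OF linear_compose[OF linear_inv_psi linear_gram_left] linear_psi]
    by (simp add: B_def[abs_def] o_def)
  ultimately have B: "bounded_bilinear B"
    by (simp add: bilinear_conv_bounded_bilinear[symmetric] bilinear_def)
  have S: "?S = {x. B x x = psi (mat 1 :: quat ^ 'p ^ 'p)}"
  proof -
    have "psi X \<in> ?S \<longleftrightarrow> B (psi X) (psi X) = psi (mat 1)" for X
      by (simp add: B_def inv_psi_psi inj_image_mem_iff[OF bij_is_inj[OF bij_psi]]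
          inj_eq[OF bij_is_inj[OF bij_psi]] stiefel_iff_gram)
    from this[of "inv psi x" for x] show ?thesis
      unfolding psi_inv_psi by blast
  qed
  have chart: "\<exists>U V (f :: ('p, 'n) quat_coords \<Rightarrow> ('p, 'n) quat_coords) g L.
      a \<in> U \<and> diffeomorphism U V f g \<and> subspace L \<and> dim L = ?d \<and> f ` (?S \<inter> U) = L \<inter> V"
    if "a \<in> ?S" for a
  proof -
    define A where "A = inv psi a"
    have A: "gram G A A = mat 1"
      using that by (auto simp: A_def inv_psi_psi stiefel_iff_gram)
    have Baa: "B a a = psi (mat 1)"
      using that S by simp
    define R where "R m = psi ((1/2) *\<^sub>R (A ** inv psi m))"
      for m :: "('p, 'p) quat_coords"
    define T where "T h = B a h + B h a" for h
    have linR: "linear R"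
      by (rule linearI)
        (simp_all add: R_def linear_add[OF linear_inv_psi] linear_scale[OF linear_inv_psi]
          matrix_add_ldistrib quat_matrix_scaleR_right linear_add[OF linear_psi]
          linear_scale[OF linear_psi] scaleR_add_right)
    have linT: "linear T"
      unfolding T_def[abs_def] by (intro linear_compose_add) fact+
    \<comment> \<open>\<open>A M / 2\<close> is mapped to \<open>M / 2 + M\<^sup>H / 2\<close>.\<close>
    have TR: "T (R (psi M)) = psi M" if "qhermitian M" for M :: "quat ^ 'p ^ 'p"
    proof -
      have "T (R (psi M)) = psi (gram G A ((1/2) *\<^sub>R (A ** M)) + gram G ((1/2) *\<^sub>R (A ** M)) A)"
        by (simp add: T_def B_def R_def inv_psi_psi A_def linear_add[OF linear_psi])
      also have "gram G A ((1/2) *\<^sub>R (A ** M)) = (1/2) *\<^sub>R M"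
        by (simp add: linear_scale[OF linear_gram_right] gram_mult_right A)
      also have "gram G ((1/2) *\<^sub>R (A ** M)) A = (1/2) *\<^sub>R M"
        using that by (simp add: linear_scale[OF linear_gram_left] gram_mult_left A qhermitian_def)
      also have "(1/2) *\<^sub>R M + (1/2) *\<^sub>R M = M"
        by (simp flip: scaleR_add_left)
      finally show ?thesis .
    qed
    have BR: "B a (R (B h h)) + B (R (B h h)) a = B h h" for h
    proof -
      have "qhermitian (gram G (inv psi h) (inv psi h) :: quat ^ 'p ^ 'p)"
        by (simp add: qhermitian_def conj_transpose_gram[OF herm])
      from TR[OF this] show ?thesis
        unfolding T_def by (simp add: B_def)
    qed
    have "range T = psi ` {M :: quat ^ 'p ^ 'p. qhermitian M}"
    proof (intro equalityI subsetI)
      fix y assume "y \<in> range T"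
      then obtain h where "y = psi (gram G A (inv psi h) + gram G (inv psi h) A)"
        by (auto simp: T_def B_def A_def linear_add[OF linear_psi])
      moreover have "qhermitian (gram G A (inv psi h) + gram G (inv psi h) A)"
        by (simp add: qhermitian_def conj_transpose_add conj_transpose_gram[OF herm] add.commute)
      ultimately show "y \<in> psi ` {M. qhermitian M}" by blast
    next
      fix y assume "y \<in> psi ` {M :: quat ^ 'p ^ 'p. qhermitian M}"
      then obtain M :: "quat ^ 'p ^ 'p" where "qhermitian M" "y = psi M" by blast
      with TR[of M] have "y = T (R (psi M))" by simp
      then show "y \<in> range T" by blast
    qed
    then have "dim {h. T h = 0} + CARD('p) * (2 * CARD('p) - 1) = 4 * CARD('n) * CARD('p)"
      using dim_kernel_range[OF linT] by (simp add: dim_psi_hermitian_matrices DIM_psi_codomain)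
    moreover have "?d + CARD('p) * (2 * CARD('p) - 1) = 4 * CARD('n) * CARD('p)"
    proof -
      have "4 * CARD('n) - 2 * CARD('p) + 1 + (2 * CARD('p) - 1) = 4 * CARD('n)"
        using assms(1) zero_less_card_finite[where 'a='p] by linarith
      then show ?thesis by (metis distrib_left mult.commute)
    qed
    ultimately have "dim {h. T h = 0} = ?d" by linarith
    moreover have "subspace {h. T h = 0}"
      using linT by (rule linear_subspace_kernel)
    moreover obtain U V f g where "a \<in> U" "diffeomorphism U V f g"
      and "f ` ({x. B x x = B a a} \<inter> U) = {h. T h = 0} \<inter> V"
      unfolding T_def by (rule quadric_slice_chart[OF B linR BR])
    moreover from this(3) have "f ` (?S \<inter> U) = {h. T h = 0} \<inter> V"
      unfolding S Baa .
    ultimately show ?thesis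
      by blast
  qed
  have "?S \<noteq> {}"
    using stiefel_nonempty[OF assms] by simp
  with chart show ?thesis
    unfolding embedded_submanifold_def by blast
qed

end
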